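(* Suppose the collocated residual $\rho(\theta)\in\mathbb R^{N_{\mathcal D}}$ admits the finite canonical representation $$\rho(\theta)(\overline{i_1\ldots i_d})=\sum_{\eta=1}^{R_\rho}\prod_{m=1}^d\mathsf Y_m(i_m,\eta),\qquad \mathsf Y_m\in\mathbb R^{n_m\times R_\rho}.$$ For every $s=1,\dots,d$ and $\beta=1,\dots,R_{\mathcal A}$ define $$\mathsf Q_m^{(\beta)}:=\frac1{n_m}(\mathsf F_m^{(\beta)})^\top\mathsf Y_m\in\mathbb R^{R\times R_\rho},\qquad \mathsf Q_{-s}^{(\beta)}:=\mathop{\bigcirc}_{m\ne s}\mathsf Q_m^{(\beta)}\in\mathbb R^{R\times R_\rho},\qquad \mathsf P_s^{(\beta)}:=\frac1{n_s}\mathsf Y_s(\mathsf Q_{-s}^{(\beta)})^\top\in\mathbb R^{n_s\times R}.$$ Then the compressed residual block $\rho_{\mathrm c,s}^{(\beta)}:=\frac1{N_{\mathcal D}}(\Psi_s^{(\beta)})^\top\rho(\theta)$ is the vectorization of $\mathsf P_s^{(\beta)}$: $$\rho_{\mathrm c,s}^{(\beta)}=\operatorname{vec}(\mathsf P_s^{(\beta)})\in\mathbb R^{n_sR},\qquad \rho_{\mathrm c,s}^{(\beta)}(\overline{i_s\alpha})=\mathsf P_s^{(\beta)}(i_s,\alpha).$$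
   Context: $\mathcal D=\mathcal D_1\times\cdots\times\mathcal D_d$ with bounded open intervals $\mathcal D_m$; $H_m\hookrightarrow L^2(\mathcal D_m)$ Hilbert spaces; the rank-$R$ separable ansatz is $u_\theta(z)=\sum_{\alpha=1}^R\prod_{m=1}^du_m^\alpha(z_m;\theta^m)$ with $u_m^\alpha(\cdot;\theta^m)\in H_m$; $\mathcal A=\sum_{\beta=1}^{R_{\mathcal A}}\mathcal A_1^{(\beta)}\otimes\cdots\otimes\mathcal A_d^{(\beta)}$ with bounded linear $\mathcal A_m^{(\beta)}:H_m\to L^2(\mathcal D_m)$, and $\mathcal A_m^{(\beta)}u_m^\alpha$ has a continuous representative. Factor grids: $\mathcal X_m=\{z_{m,1},\dots,z_{m,n_m}\}\subset\mathcal D_m$, $N_{\mathcal D}=\prod_mn_m$. The collocated residual is $\rho(\theta)(\overline{i_1\ldots i_d})=(\mathcal Au_\theta-f)(z_{1,i_1},\dots,z_{d,i_d})$ for a given source $f$ admitting pointwise evaluation. Index convention: $\overline{i_1\ldots i_k}$ is the lexicographic position of $(i_1,\dots,i_k)$ (leftmost index slowest); $\operatorname{vec}(A)(\overline{ij})=A(i,j)$. $\circ$ denotes the Hadamard product (an empty Hadamard product is the all-ones matrix). $\mathsf F_m^{(\beta)}\in\mathbb R^{n_m\times R}$, $\mathsf F_m^{(\beta)}(i_m,\alpha)=(\mathcal A_m^{(\beta)}u_m^\alpha)(z_{m,i_m})$. $\Psi_s^{(\beta)}\in\mathbb R^{N_{\mathcal D}\times n_sR}$ is defined by $\Psi_s^{(\beta)}(\overline{i_1\ldots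 i_d},\overline{j_s\alpha})=\delta_{i_sj_s}\prod_{m\ne s}\mathsf F_m^{(\beta)}(i_m,\alpha)$. *)

theory Defs
  imports "HOL-Analysis.Analysis" "Jordan_Normal_Form.Matrix"
begin

unbundle no vec_syntax

text \<open>
  All indices start at 0: modes are \<open>m < d\<close>, grid points \<open>i < n\<^sub>m\<close>, summands \<open>\<alpha> < R\<close>, and so on;
  matrices and vectors are those of \<^theory>\<open>Jordan_Normal_Form.Matrix\<close>.
\<close>

section \<open>Multi-indices and their lexicographic position\<close>

text \<open>A multi-index is a list; the leftmost entry is the most significant one.\<close>

definition multi_indices :: "nat list \<Rightarrow> nat list set" where
  "multi_indices ns = {is. length is = length ns \<and> (\<forall>k<length ns. is ! k < ns ! k)}"

definition lex_pos :: "nat list \<Rightarrow> nat list \<Rightarrow> nat" where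
  "lex_pos ns is = card {js \<in> multi_indices ns. (js, is) \<in> lex less_than}"

definition multi_index_of :: "nat list \<Rightarrow> nat \<Rightarrow> nat list" where
  "multi_index_of ns p = the_inv_into (multi_indices ns) (lex_pos ns) p"

lemma multi_indices_listset: "multi_indices ns = listset (map lessThan ns)"
proof (induction ns)
  case (Cons n ns)
  show ?case
  proof (rule Set.set_eqI)
    fix xs show "xs \<in> multi_indices (n # ns) \<longleftrightarrow> xs \<in> listset (map lessThan (n # ns))"
      using Cons.IH[symmetric]
      by (cases xs) (auto simp: multi_indices_def set_Cons_def All_less_Suc2)
  qed
qed (simp add: multi_indices_def)

lemma finite_multi_indices: "finite (multi_indices ns)"
proof -
  have "multi_indices ns \<subseteq> {xs. set xs \<subseteq> {..<Suc (sum_list ns)} \<and> length xs = length ns}"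
  proof
    fix xs assume "xs \<in> multi_indices ns"
    hence l: "length xs = length ns" and b: "\<forall>k<length ns. xs ! k < ns ! k"
      by (auto simp: multi_indices_def)
    have "xs ! k < Suc (sum_list ns)" if "k < length xs" for k
      using b elem_le_sum_list[of k ns] that l by force
    thus "xs \<in> {xs. set xs \<subseteq> {..<Suc (sum_list ns)} \<and> length xs = length ns}"
      using l by (auto simp: in_set_conv_nth)
  qed
  thus ?thesis by (rule finite_subset) (rule finite_lists_length_eq, simp)
qed

lemma card_multi_indices: "card (multi_indices ns) = prod_list ns"
proof (induction ns)
  case (Cons n ns)
  have "listset (map lessThan (n # ns)) = (\<lambda>(x, xs). x # xs) ` ({..<n} \<times> multi_indices ns)"
    by (auto simp: set_Cons_def multi_indices_listset)
  moreover have "inj_on (\<lambda>(x, xs). x # xs) ({..<n} \<times> multi_indices ns)"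
    by (auto simp: inj_on_def)
  ultimately show ?case
    by (simp add: multi_indices_listset card_image Cons.IH[unfolded multi_indices_listset]
        card_cartesian_product)
qed (simp add: multi_indices_def)

lemma lex_pos_bij_betw: "bij_betw (lex_pos ns) (multi_indices ns) {..<prod_list ns}"
proof -
  let ?I = "multi_indices ns" and ?r = "lex less_than"
  have trans: "trans ?r" by (simp add: lex_transI)
  have irr: "(x, x) \<notin> ?r" for x by (simp add: lexl_not_refl irrefl_less_than irreflD)
  have less: "lex_pos ns x < lex_pos ns y" if "x \<in> ?I" "(x, y) \<in> ?r" for x y
    unfolding lex_pos_def
    by (rule psubset_card_mono)
       (use that irr trans finite_multi_indices in \<open>auto dest: transD\<close>)
  have tot: "x = y \<or> (x, y) \<in> ?r \<or> (y, x) \<in> ?r" if "x \<in> ?I" "y \<in> ?I" for x y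
  proof -
    have l: "length x = length y" using that by (simp add: multi_indices_def)
    have "x = y \<or> (x, y) \<in> lenlex less_than \<or> (y, x) \<in> lenlex less_than"
      using total_lenlex[OF total_less_than] unfolding total_on_def by blast
    thus ?thesis using l by (simp add: lenlex_conv)
  qed
  have inj: "inj_on (lex_pos ns) ?I"
    by (rule inj_onI) (metis less tot less_irrefl)
  have bnd: "lex_pos ns x < prod_list ns" if "x \<in> ?I" for x
    unfolding lex_pos_def card_multi_indices[symmetric]
    by (rule psubset_card_mono) (use that irr finite_multi_indices in auto)
  have "lex_pos ns ` ?I = {..<prod_list ns}"
    by (rule card_subset_eq) (use bnd in \<open>auto simp: card_image[OF inj] card_multi_indices\<close>)
  with inj show ?thesis by (simp add: bij_betw_def)
qed

lemma multi_index_of_lex_pos: "is \<in> multi_indices ns \<Longrightarrow> multi_index_of ns (lex_pos ns is) = is"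
  unfolding multi_index_of_def
  by (rule the_inv_into_f_f) (use lex_pos_bij_betw in \<open>auto simp: bij_betw_def\<close>)

definition vectorize :: "real mat \<Rightarrow> real Matrix.vec" where
  "vectorize A = Matrix.vec (dim_row A * dim_col A)
     (\<lambda>p. let ij = multi_index_of [dim_row A, dim_col A] p in A $$ (ij ! 0, ij ! 1))"

text \<open>\<open>hadamard nr nc S Q\<close> is the Hadamard product of the \<open>nr \<times> nc\<close> matrices \<open>Q m\<close>, \<open>m \<in> S\<close>.\<close>

definition hadamard :: "nat \<Rightarrow> nat \<Rightarrow> 'i set \<Rightarrow> ('i \<Rightarrow> real mat) \<Rightarrow> real mat" where
  "hadamard nr nc S Q = Matrix.mat nr nc (\<lambda>(i, j). \<Prod>m\<in>S. Q m $$ (i, j))"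

section \<open>\<open>L\<^sup>2\<close> spaces and continuous representatives\<close>

text \<open>Elements of \<open>L\<^sup>2(D)\<close> are handled through representatives, identified when equal a.e. on \<open>D\<close>.\<close>

definition L2_on :: "real set \<Rightarrow> (real \<Rightarrow> real) set" where
  "L2_on D = {g \<in> borel_measurable (lebesgue_on D). integrable (lebesgue_on D) (\<lambda>x. (g x)\<^sup>2)}"

definition L2_norm_on :: "real set \<Rightarrow> (real \<Rightarrow> real) \<Rightarrow> real" where
  "L2_norm_on D g = sqrt (integral\<^sup>L (lebesgue_on D) (\<lambda>x. (g x)\<^sup>2))"

definition bounded_linear_L2 :: "'h::real_inner set \<Rightarrow> real set \<Rightarrow> ('h \<Rightarrow> real \<Rightarrow> real) \<Rightarrow> bool" where
  "bounded_linear_L2 V D T \<longleftrightarrow>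
     (\<forall>v\<in>V. T v \<in> L2_on D) \<and>
     (\<forall>v\<in>V. \<forall>w\<in>V. AE x in lebesgue_on D. T (v + w) x = T v x + T w x) \<and>
     (\<forall>c. \<forall>v\<in>V. AE x in lebesgue_on D. T (c *\<^sub>R v) x = c * T v x) \<and>
     (\<exists>C. \<forall>v\<in>V. L2_norm_on D (T v) \<le> C * norm v)"

definition is_cont_rep :: "'a::topological_space measure \<Rightarrow> ('a \<Rightarrow> real) \<Rightarrow> ('a \<Rightarrow> real) \<Rightarrow> bool" where
  "is_cont_rep M g h \<longleftrightarrow> continuous_on (space M) h \<and> (AE x in M. h x = g x)"

text \<open>
  On a nonempty open interval, and on a box of such intervals, a continuous representative is
  unique at every point of the domain, so its values there do not depend on the choice.
\<close>

definition cont_rep :: "'a::topological_space measure \<Rightarrow> ('a \<Rightarrow> real) \<Rightarrow> 'a \<Rightarrow> real" where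
  "cont_rep M g = (SOME h. is_cont_rep M g h)"

section \<open>Separable ansatz and collocated residual\<close>

text \<open>
  \<open>hilb m\<close> is \<open>H\<^sub>m\<close>, carried by a subset of one ambient inner product space (any finite family of
  Hilbert spaces embeds isometrically into its direct sum); \<open>embed m\<close> is \<open>H\<^sub>m \<hookrightarrow> L\<^sup>2(D\<^sub>m)\<close>;
  \<open>factor_op \<beta> m\<close> and \<open>full_op\<close> are the operators \<open>\<A>\<^sub>m\<^sup>(\<^sup>\<beta>\<^sup>)\<close> and \<open>\<A>\<close>; \<open>factor m \<alpha> t\<close> is
  \<open>u\<^sub>m\<^sup>\<alpha>(\<cdot>; t)\<close>. A point of \<open>D\<close> is a function in \<open>PiE {..<d} D\<close>.
\<close>

record ('h, 'p) separable_problem =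
  ndim :: nat
  lower :: "nat \<Rightarrow> real"
  upper :: "nat \<Rightarrow> real"
  hilb :: "nat \<Rightarrow> 'h set"
  embed :: "nat \<Rightarrow> 'h \<Rightarrow> real \<Rightarrow> real"
  op_rank :: nat
  factor_op :: "nat \<Rightarrow> nat \<Rightarrow> 'h \<Rightarrow> real \<Rightarrow> real"
  full_op :: "((nat \<Rightarrow> real) \<Rightarrow> real) \<Rightarrow> (nat \<Rightarrow> real) \<Rightarrow> real"
  sep_rank :: nat
  factor :: "nat \<Rightarrow> nat \<Rightarrow> 'p \<Rightarrow> 'h"
  source :: "(nat \<Rightarrow> real) \<Rightarrow> real"
  grid_size :: "nat \<Rightarrow> nat"
  grid :: "nat \<Rightarrow> nat \<Rightarrow> real"

definition dom1 :: "('h, 'p) separable_problem \<Rightarrow> nat \<Rightarrow> real set" where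
  "dom1 P m = {lower P m <..< upper P m}"

definition dom_measure :: "('h, 'p) separable_problem \<Rightarrow> (nat \<Rightarrow> real) measure" where
  "dom_measure P = PiM {..<ndim P} (\<lambda>m. lebesgue_on (dom1 P m))"

text \<open>
  \<open>\<A> = \<Sum>\<beta>. \<A>\<^sub>1\<^sup>(\<^sup>\<beta>\<^sup>) \<otimes> \<dots> \<otimes> \<A>\<^sub>d\<^sup>(\<^sup>\<beta>\<^sup>)\<close>: the linear operator, well defined on a.e. classes, whose
  action on the algebraic tensor product of the \<open>H\<^sub>m\<close> is given factorwise on elementary tensors.
\<close>

definition is_tensor_sum_op :: "('h, 'p) separable_problem \<Rightarrow> bool" where
  "is_tensor_sum_op P \<longleftrightarrow>
     (\<forall>K (h :: nat \<Rightarrow> nat \<Rightarrow> 'h) w.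
        (\<forall>k<K. \<forall>m<ndim P. h k m \<in> hilb P m) \<longrightarrow>
        (AE x in dom_measure P. w x = (\<Sum>k<K. \<Prod>m<ndim P. embed P m (h k m) (x m))) \<longrightarrow>
        (AE x in dom_measure P. full_op P w x =
           (\<Sum>\<beta><op_rank P. \<Sum>k<K. \<Prod>m<ndim P. factor_op P \<beta> m (h k m) (x m))))"

locale separable_collocation =
  fixes P :: "('h::real_inner, 'p) separable_problem" and \<theta> :: "nat \<Rightarrow> 'p"
  assumes interval: "\<And>m. m < ndim P \<Longrightarrow> lower P m < upper P m"
    and hilbert: "\<And>m. m < ndim P \<Longrightarrow> subspace (hilb P m) \<and> complete (hilb P m)"
    and embed_bounded_linear: "\<And>m. m < ndim P \<Longrightarrow> bounded_linear_L2 (hilb P m) (dom1 P m) (embed P m)"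
    and embed_inj: "\<And>m v. \<lbrakk>m < ndim P; v \<in> hilb P m; AE x in lebesgue_on (dom1 P m). embed P m v x = 0\<rbrakk>
                      \<Longrightarrow> v = 0"
    and factor_op_bounded_linear: "\<And>\<beta> m. \<lbrakk>\<beta> < op_rank P; m < ndim P\<rbrakk>
                      \<Longrightarrow> bounded_linear_L2 (hilb P m) (dom1 P m) (factor_op P \<beta> m)"
    and tensor_sum_op: "is_tensor_sum_op P"
    and factor_mem: "\<And>m \<alpha>. \<lbrakk>m < ndim P; \<alpha> < sep_rank P\<rbrakk> \<Longrightarrow> factor P m \<alpha> (\<theta> m) \<in> hilb P m"
    and factor_cont_rep: "\<And>\<beta> m \<alpha>. \<lbrakk>\<beta> < op_rank P; m < ndim P; \<alpha> < sep_rank P\<rbrakk>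
                      \<Longrightarrow> \<exists>h. is_cont_rep (lebesgue_on (dom1 P m)) (factor_op P \<beta> m (factor P m \<alpha> (\<theta> m))) h"
    and grid_nonempty: "\<And>m. m < ndim P \<Longrightarrow> 0 < grid_size P m"
    and grid_mem: "\<And>m i. \<lbrakk>m < ndim P; i < grid_size P m\<rbrakk> \<Longrightarrow> grid P m i \<in> dom1 P m"

definition ansatz :: "('h, 'p) separable_problem \<Rightarrow> (nat \<Rightarrow> 'p) \<Rightarrow> (nat \<Rightarrow> real) \<Rightarrow> real" where
  "ansatz P \<theta> x = (\<Sum>\<alpha><sep_rank P. \<Prod>m<ndim P. embed P m (factor P m \<alpha> (\<theta> m)) (x m))"

definition grid_sizes :: "('h, 'p) separable_problem \<Rightarrow> nat list" where
  "grid_sizes P = map (grid_size P) [0..<ndim P]"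

definition num_points :: "('h, 'p) separable_problem \<Rightarrow> nat" where
  "num_points P = (\<Prod>m<ndim P. grid_size P m)"

definition grid_point :: "('h, 'p) separable_problem \<Rightarrow> nat list \<Rightarrow> nat \<Rightarrow> real" where
  "grid_point P is = (\<lambda>m\<in>{..<ndim P}. grid P m (is ! m))"

definition residual :: "('h, 'p) separable_problem \<Rightarrow> (nat \<Rightarrow> 'p) \<Rightarrow> real Matrix.vec" where
  "residual P \<theta> = Matrix.vec (num_points P)
     (\<lambda>p. let x = grid_point P (multi_index_of (grid_sizes P) p)
          in cont_rep (dom_measure P) (full_op P (ansatz P \<theta>)) x - source P x)"

definition F_mat :: "('h, 'p) separable_problem \<Rightarrow> (nat \<Rightarrow> 'p) \<Rightarrow> nat \<Rightarrow> nat \<Rightarrow> real mat" where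
  "F_mat P \<theta> \<beta> m = Matrix.mat (grid_size P m) (sep_rank P)
     (\<lambda>(i, \<alpha>). cont_rep (lebesgue_on (dom1 P m)) (factor_op P \<beta> m (factor P m \<alpha> (\<theta> m))) (grid P m i))"

definition Psi_mat :: "('h, 'p) separable_problem \<Rightarrow> (nat \<Rightarrow> 'p) \<Rightarrow> nat \<Rightarrow> nat \<Rightarrow> real mat" where
  "Psi_mat P \<theta> \<beta> s = Matrix.mat (num_points P) (grid_size P s * sep_rank P)
     (\<lambda>(p, q). let is = multi_index_of (grid_sizes P) p;
                   j\<alpha> = multi_index_of [grid_size P s, sep_rank P] q;
                   j = j\<alpha> ! 0; \<alpha> = j\<alpha> ! 1
               in (if is ! s = j then 1 else 0) *
                  (\<Prod>m\<in>{..<ndim P} - {s}. F_mat P \<theta> \<beta> m $$ (is ! m, \<alpha>)))"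

section \<open>Compressed residual\<close>

definition Q_mat ::
  "('h, 'p) separable_problem \<Rightarrow> (nat \<Rightarrow> 'p) \<Rightarrow> (nat \<Rightarrow> real mat) \<Rightarrow> nat \<Rightarrow> nat \<Rightarrow> real mat" where
  "Q_mat P \<theta> Y \<beta> m = (1 / real (grid_size P m)) \<cdot>\<^sub>m ((F_mat P \<theta> \<beta> m)\<^sup>T * Y m)"

definition Q_minus_mat ::
  "('h, 'p) separable_problem \<Rightarrow> (nat \<Rightarrow> 'p) \<Rightarrow> nat \<Rightarrow> (nat \<Rightarrow> real mat) \<Rightarrow> nat \<Rightarrow> nat \<Rightarrow> real mat" where
  "Q_minus_mat P \<theta> R\<^sub>\<rho> Y \<beta> s = hadamard (sep_rank P) R\<^sub>\<rho> ({..<ndim P} - {s}) (Q_mat P \<theta> Y \<beta>)"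

definition P_mat ::
  "('h, 'p) separable_problem \<Rightarrow> (nat \<Rightarrow> 'p) \<Rightarrow> nat \<Rightarrow> (nat \<Rightarrow> real mat) \<Rightarrow> nat \<Rightarrow> nat \<Rightarrow> real mat" where
  "P_mat P \<theta> R\<^sub>\<rho> Y \<beta> s = (1 / real (grid_size P s)) \<cdot>\<^sub>m (Y s * (Q_minus_mat P \<theta> R\<^sub>\<rho> Y \<beta> s)\<^sup>T)"

definition compressed_residual ::
  "('h, 'p) separable_problem \<Rightarrow> (nat \<Rightarrow> 'p) \<Rightarrow> nat \<Rightarrow> nat \<Rightarrow> real Matrix.vec" where
  "compressed_residual P \<theta> \<beta> s =
     (1 / real (num_points P)) \<cdot>\<^sub>v ((Psi_mat P \<theta> \<beta> s)\<^sup>T *\<^sub>v residual P \<theta>)"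

end

theory Submission
  imports Defs
begin

text \<open>
  In the \<open>(i, \<alpha>)\<close> entry of \<open>\<Psi>\<^sub>s\<^sup>T \<rho>\<close>, both the column of \<open>\<Psi>\<^sub>s\<close> and each of the
  \<open>R\<^sub>\<rho>\<close> summands of \<open>\<rho>\<close> are products over the modes. Hence the sum over all grid points factors into
  one-dimensional sums: the mode \<open>s\<close> selects \<open>Y\<^sub>s(i, \<eta>)\<close>, and each other mode gives
  an entry of \<open>F\<^sub>m\<^sup>T Y\<^sub>m\<close>. The weight \<open>1 / N\<close> splits in the same way.
\<close>

text \<open>Distributivity, by peeling off the first mode. The family \<open>g\<close> is kept
  arbitrary in the induction because the tail sees its modes shifted by one. This is what factors a
  sum over all grid points into one-dimensional sums.\<close>

lemma sum_multi_indices_prod: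
  fixes g :: "nat \<Rightarrow> nat \<Rightarrow> 'a::comm_semiring_1"
  shows "(\<Sum>is\<in>multi_indices ns. \<Prod>m<length ns. g m (is ! m)) = (\<Prod>m<length ns. \<Sum>k<ns ! m. g m k)"
proof (induction ns arbitrary: g)
  case Nil
  then show ?case by (simp add: multi_indices_def)
next
  case (Cons n ns)
  \<comment> \<open>Head and tail of a multi-index range independently, so the sum can be reindexed
    over a Cartesian product.\<close>
  have "multi_indices (n # ns) = (\<lambda>(k, is). k # is) ` ({..<n} \<times> multi_indices ns)"
    by (auto simp: set_Cons_def multi_indices_listset)
  moreover have "inj_on (\<lambda>(k, is). k # is) ({..<n} \<times> multi_indices ns)"
    by (auto simp: inj_on_def)
  ultimately have "(\<Sum>is\<in>multi_indices (n # ns). \<Prod>m<length (n # ns). g m (is ! m)) =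
      (\<Sum>(k, is)\<in>{..<n} \<times> multi_indices ns. g 0 k * (\<Prod>m<length ns. g (Suc m) (is ! m)))"
    by (simp add: sum.reindex prod.lessThan_Suc_shift case_prod_unfold del: prod.lessThan_Suc)
  also have "\<dots> = (\<Sum>k<n. g 0 k) * (\<Sum>is\<in>multi_indices ns. \<Prod>m<length ns. g (Suc m) (is ! m))"
    by (simp add: sum_product sum.cartesian_product)
  also have "\<dots> = (\<Prod>m<length (n # ns). \<Sum>k<(n # ns) ! m. g m k)"
    by (simp add: Cons.IH[of "\<lambda>m. g (Suc m)"] prod.lessThan_Suc_shift del: prod.lessThan_Suc)
  finally show ?case .
qed

lemma length_grid_sizes [simp]: "length (grid_sizes P) = ndim P"
  by (simp add: grid_sizes_def)

lemma nth_grid_sizes [simp]: "m < ndim P \<Longrightarrow> grid_sizes P ! m = grid_size P m"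
  by (simp add: grid_sizes_def)

lemma prod_list_grid_sizes: "prod_list (grid_sizes P) = num_points P"
  by (simp add: grid_sizes_def num_points_def prod.list_conv_set_nth atLeast0LessThan)

text \<open>Moves sums from row positions to multi-indices, where \<open>multi_index_of\<close>
  cancels against \<open>lex_pos\<close> and the canonical representation of the residual is
  available.\<close>

lemma sum_lex_pos:
  "(\<Sum>p<prod_list ns. f p) = (\<Sum>is\<in>multi_indices ns. f (lex_pos ns is))"
  by (rule sum.reindex_bij_betw[OF lex_pos_bij_betw, symmetric])

lemma lex_pos_less: "is \<in> multi_indices ns \<Longrightarrow> lex_pos ns is < prod_list ns"
  using bij_betwE[OF lex_pos_bij_betw] by blast

lemma pair_mem_multi_indices: "[i, j] \<in> multi_indices [m, n] \<longleftrightarrow> i < m \<and> j < n"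
  by (auto simp: multi_indices_def All_less_Suc2)

lemma lex_pos_pair_less: "i < m \<Longrightarrow> j < n \<Longrightarrow> lex_pos [m, n] [i, j] < m * n"
  using lex_pos_less[of "[i, j]" "[m, n]"] by (simp add: pair_mem_multi_indices)

text \<open>Surjectivity of \<open>lex_pos\<close>: an identity between vectors of length
  \<open>m * n\<close> needs checking only at positions of pairs.\<close>

lemma lex_pos_pair_cases:
  assumes "q < m * n"
  obtains i j where "i < m" "j < n" "q = lex_pos [m, n] [i, j]"
proof -
  have "q \<in> lex_pos [m, n] ` multi_indices [m, n]"
    using lex_pos_bij_betw[of "[m, n]"] assms by (simp add: bij_betw_def)
  then obtain "is" where "is": "is \<in> multi_indices [m, n]" "q = lex_pos [m, n] is"
    by blast
  moreover obtain i j where "is = [i, j]"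
    using "is"(1) by (auto simp: multi_indices_def length_Suc_conv)
  ultimately show thesis
    using that pair_mem_multi_indices by blast
qed

lemma vectorize_lex_pos:
  assumes "A \<in> carrier_mat m n" "i < m" "j < n"
  shows "vectorize A $ lex_pos [m, n] [i, j] = A $$ (i, j)"
  using assms
  by (auto simp: vectorize_def lex_pos_pair_less multi_index_of_lex_pos pair_mem_multi_indices)

lemma compressed_residual_carrier:
  "compressed_residual P \<theta> \<beta> s \<in> carrier_vec (grid_size P s * sep_rank P)"
  by (simp add: compressed_residual_def Psi_mat_def carrier_vecI)

lemma Q_mat_carrier:
  assumes "Y m \<in> carrier_mat (grid_size P m) R\<^sub>\<rho>"
  shows "Q_mat P \<theta> Y \<beta> m \<in> carrier_mat (sep_rank P) R\<^sub>\<rho>"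
  using assms by (auto simp: Q_mat_def F_mat_def)

lemma Q_minus_mat_carrier: "Q_minus_mat P \<theta> R\<^sub>\<rho> Y \<beta> s \<in> carrier_mat (sep_rank P) R\<^sub>\<rho>"
  by (simp add: Q_minus_mat_def hadamard_def)

lemma P_mat_carrier:
  assumes "Y s \<in> carrier_mat (grid_size P s) R\<^sub>\<rho>"
  shows "P_mat P \<theta> R\<^sub>\<rho> Y \<beta> s \<in> carrier_mat (grid_size P s) (sep_rank P)"
  using assms Q_minus_mat_carrier[of P \<theta> R\<^sub>\<rho> Y \<beta> s] by (auto simp: P_mat_def)

lemma Q_mat_index:
  assumes "Y m \<in> carrier_mat (grid_size P m) R\<^sub>\<rho>" "\<alpha> < sep_rank P" "\<eta> < R\<^sub>\<rho>"
  shows "Q_mat P \<theta> Y \<beta> m $$ (\<alpha>, \<eta>) =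
    (\<Sum>k<grid_size P m. F_mat P \<theta> \<beta> m $$ (k, \<alpha>) * Y m $$ (k, \<eta>)) / real (grid_size P m)"
  using assms
  by (auto simp: Q_mat_def F_mat_def scalar_prod_def atLeast0LessThan intro!: sum.cong)

text \<open>Gathers all weights in one place: the factor 1/n_s of \<open>P_mat\<close> and the
  factors 1/n_m of the \<open>Q_mat\<close> with m different from \<open>s\<close> multiply to the
  single weight 1/N that also stands in the compressed residual.\<close>

lemma P_mat_index:
  assumes "\<And>m. m < ndim P \<Longrightarrow> Y m \<in> carrier_mat (grid_size P m) R\<^sub>\<rho>"
    and "s < ndim P" "i < grid_size P s" "\<alpha> < sep_rank P"
  shows "P_mat P \<theta> R\<^sub>\<rho> Y \<beta> s $$ (i, \<alpha>) =
    (\<Sum>\<eta><R\<^sub>\<rho>. Y s $$ (i, \<eta>) * (\<Prod>m\<in>{..<ndim P} - {s}.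
       \<Sum>k<grid_size P m. F_mat P \<theta> \<beta> m $$ (k, \<alpha>) * Y m $$ (k, \<eta>))) / real (num_points P)"
proof -
  have N: "real (num_points P) = real (grid_size P s) * (\<Prod>m\<in>{..<ndim P} - {s}. real (grid_size P m))"
    using assms(2) by (simp add: num_points_def prod.remove[of _ s])
  have "P_mat P \<theta> R\<^sub>\<rho> Y \<beta> s $$ (i, \<alpha>) =
      (\<Sum>\<eta><R\<^sub>\<rho>. Y s $$ (i, \<eta>) * (\<Prod>m\<in>{..<ndim P} - {s}. Q_mat P \<theta> Y \<beta> m $$ (\<alpha>, \<eta>))) /
      real (grid_size P s)"
    using assms(1)[OF assms(2)] assms(3,4)
    by (auto simp: P_mat_def Q_minus_mat_def hadamard_def scalar_prod_def atLeast0LessThan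
        intro!: sum.cong)
  also have "\<dots> = (\<Sum>\<eta><R\<^sub>\<rho>. Y s $$ (i, \<eta>) * (\<Prod>m\<in>{..<ndim P} - {s}.
      (\<Sum>k<grid_size P m. F_mat P \<theta> \<beta> m $$ (k, \<alpha>) * Y m $$ (k, \<eta>)) / real (grid_size P m))) /
      real (grid_size P s)"
    \<comment> \<open>The congruence rules supply \<open>\<eta> < R\<^sub>\<rho>\<close> and
      \<open>m < ndim P\<close>, the side conditions of \<open>Q_mat_index\<close>.\<close>
    using assms(4) by (simp add: Q_mat_index[OF assms(1)] cong: sum.cong_simp prod.cong_simp)
  also have "\<dots> = (\<Sum>\<eta><R\<^sub>\<rho>. Y s $$ (i, \<eta>) * (\<Prod>m\<in>{..<ndim P} - {s}.
       \<Sum>k<grid_size P m. F_mat P \<theta> \<beta> m $$ (k, \<alpha>) * Y m $$ (k, \<eta>))) / real (num_points P)"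
    by (simp add: N prod_dividef sum_divide_distrib[symmetric] mult.commute)
  finally show ?thesis .
qed

lemma Psi_mat_index:
  assumes "is \<in> multi_indices (grid_sizes P)" "j < grid_size P s" "\<alpha> < sep_rank P"
  shows "Psi_mat P \<theta> \<beta> s $$ (lex_pos (grid_sizes P) is, lex_pos [grid_size P s, sep_rank P] [j, \<alpha>]) =
    (if is ! s = j then 1 else 0) * (\<Prod>m\<in>{..<ndim P} - {s}. F_mat P \<theta> \<beta> m $$ (is ! m, \<alpha>))"
  using assms lex_pos_less[OF assms(1)]
  by (simp add: Psi_mat_def prod_list_grid_sizes lex_pos_pair_less multi_index_of_lex_pos
      pair_mem_multi_indices)

lemma compressed_residual_index:
  assumes q: "q < grid_size P s * sep_rank P"
  shows "compressed_residual P \<theta> \<beta> s $ q =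
    (\<Sum>is\<in>multi_indices (grid_sizes P). Psi_mat P \<theta> \<beta> s $$ (lex_pos (grid_sizes P) is, q) *
      residual P \<theta> $ lex_pos (grid_sizes P) is) / real (num_points P)"
proof -
  have "compressed_residual P \<theta> \<beta> s $ q =
      (\<Sum>p<prod_list (grid_sizes P). Psi_mat P \<theta> \<beta> s $$ (p, q) * residual P \<theta> $ p) / real (num_points P)"
    unfolding prod_list_grid_sizes using q
    by (auto simp: compressed_residual_def Psi_mat_def residual_def scalar_prod_def atLeast0LessThan
        intro!: sum.cong)
  then show ?thesis
    by (simp add: sum_lex_pos)
qed

lemma compressed_residual_eq_P_mat:
  assumes Y: "\<And>m. m < ndim P \<Longrightarrow> Y m \<in> carrier_mat (grid_size P m) R\<^sub>\<rho>"
    and canonical: "\<And>is. is \<in> multi_indices (grid_sizes P) \<Longrightarrow>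
          residual P \<theta> $ lex_pos (grid_sizes P) is = (\<Sum>\<eta><R\<^sub>\<rho>. \<Prod>m<ndim P. Y m $$ (is ! m, \<eta>))"
    and s: "s < ndim P" and i: "i < grid_size P s" and \<alpha>: "\<alpha> < sep_rank P"
  shows "compressed_residual P \<theta> \<beta> s $ lex_pos [grid_size P s, sep_rank P] [i, \<alpha>] =
    P_mat P \<theta> R\<^sub>\<rho> Y \<beta> s $$ (i, \<alpha>)"
proof -
  \<comment> \<open>The column of \<Psi> has no F factor in mode \<open>s\<close>; its Kronecker
    delta fills that gap. The column times the summand \<eta> of the residual thus becomes a product
    over all modes, the shape \<open>sum_multi_indices_prod\<close> requires.\<close>
  define g where "g \<eta> m k =
    (if m = s then if k = i then 1 else 0 else F_mat P \<theta> \<beta> m $$ (k, \<alpha>)) * Y m $$ (k, \<eta>)" for \<eta> m k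
  let ?I = "multi_indices (grid_sizes P)" and ?q = "lex_pos [grid_size P s, sep_rank P] [i, \<alpha>]"
  have term_eq: "Psi_mat P \<theta> \<beta> s $$ (lex_pos (grid_sizes P) is, ?q) *
      residual P \<theta> $ lex_pos (grid_sizes P) is = (\<Sum>\<eta><R\<^sub>\<rho>. \<Prod>m<ndim P. g \<eta> m (is ! m))"
    if "is": "is \<in> ?I" for "is"
  proof -
    have "Psi_mat P \<theta> \<beta> s $$ (lex_pos (grid_sizes P) is, ?q) =
        (\<Prod>m<ndim P. if m = s then if is ! m = i then 1 else 0 else F_mat P \<theta> \<beta> m $$ (is ! m, \<alpha>))"
      using s by (simp add: Psi_mat_index[OF "is" i \<alpha>] prod.remove[of _ s])
    then show ?thesis
      by (simp add: canonical[OF "is"] g_def prod.distrib sum_distrib_left)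
  qed
  \<comment> \<open>With \<eta> moved outermost, each inner sum factors over the modes for fixed
    \<eta>. The congruence rule provides \<open>m < ndim P\<close>, under which
    \<open>grid_sizes P ! m\<close> is \<open>grid_size P m\<close>.\<close>
  have "(\<Sum>is\<in>?I. \<Sum>\<eta><R\<^sub>\<rho>. \<Prod>m<ndim P. g \<eta> m (is ! m)) =
      (\<Sum>\<eta><R\<^sub>\<rho>. \<Prod>m<ndim P. \<Sum>k<grid_size P m. g \<eta> m k)"
    using sum_multi_indices_prod[where ns = "grid_sizes P" and g = "g _"]
    by (subst sum.swap) (simp cong: prod.cong_simp)
  also have "\<dots> = (\<Sum>\<eta><R\<^sub>\<rho>. Y s $$ (i, \<eta>) * (\<Prod>m\<in>{..<ndim P} - {s}.
      \<Sum>k<grid_size P m. F_mat P \<theta> \<beta> m $$ (k, \<alpha>) * Y m $$ (k, \<eta>)))"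
  proof (rule sum.cong[OF refl])
    fix \<eta>
    \<comment> \<open>The delta leaves only \<open>k = i\<close>, which lies in the range of
      summation by \<open>i\<close>.\<close>
    have "(\<Sum>k<grid_size P s. g \<eta> s k) = Y s $$ (i, \<eta>)"
      using i by (simp add: g_def if_distrib[of "\<lambda>x. x * _"] cong: if_cong)
    then show "(\<Prod>m<ndim P. \<Sum>k<grid_size P m. g \<eta> m k) = Y s $$ (i, \<eta>) *
        (\<Prod>m\<in>{..<ndim P} - {s}. \<Sum>k<grid_size P m. F_mat P \<theta> \<beta> m $$ (k, \<alpha>) * Y m $$ (k, \<eta>))"
      using s by (simp add: prod.remove[of _ s] g_def)
  qed
  finally show ?thesis
    \<comment> \<open>Both entries are now the same sum over \<eta> divided by
      \<open>num_points P\<close>.\<close>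
    by (simp add: compressed_residual_index lex_pos_pair_less i \<alpha> term_eq P_mat_index[OF Y s i \<alpha>])
qed

theorem proposition4p2:
  fixes P :: "('h::real_inner, 'p) separable_problem" and \<theta> :: "nat \<Rightarrow> 'p"
    and R\<^sub>\<rho> :: nat and Y :: "nat \<Rightarrow> real mat" and s \<beta> :: nat
  assumes setting: "separable_collocation P \<theta>"
    and Y_dim: "\<And>m. m < ndim P \<Longrightarrow> Y m \<in> carrier_mat (grid_size P m) R\<^sub>\<rho>"
    and residual_canonical: "\<And>is. is \<in> multi_indices (grid_sizes P) \<Longrightarrow>
          residual P \<theta> $ lex_pos (grid_sizes P) is = (\<Sum>\<eta><R\<^sub>\<rho>. \<Prod>m<ndim P. Y m $$ (is ! m, \<eta>))"
    and s: "s < ndim P"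
    and \<beta>: "\<beta> < op_rank P"
  shows "(\<forall>m<ndim P. Q_mat P \<theta> Y \<beta> m \<in> carrier_mat (sep_rank P) R\<^sub>\<rho>) \<and>
         Q_minus_mat P \<theta> R\<^sub>\<rho> Y \<beta> s \<in> carrier_mat (sep_rank P) R\<^sub>\<rho> \<and>
         P_mat P \<theta> R\<^sub>\<rho> Y \<beta> s \<in> carrier_mat (grid_size P s) (sep_rank P) \<and>
         compressed_residual P \<theta> \<beta> s \<in> carrier_vec (grid_size P s * sep_rank P) \<and>
         compressed_residual P \<theta> \<beta> s = vectorize (P_mat P \<theta> R\<^sub>\<rho> Y \<beta> s) \<and>
         (\<forall>i<grid_size P s. \<forall>\<alpha><sep_rank P.
            compressed_residual P \<theta> \<beta> s $ lex_pos [grid_size P s, sep_rank P] [i, \<alpha>] =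
            P_mat P \<theta> R\<^sub>\<rho> Y \<beta> s $$ (i, \<alpha>))"
proof -
  let ?\<rho> = "compressed_residual P \<theta> \<beta> s" and ?P = "P_mat P \<theta> R\<^sub>\<rho> Y \<beta> s"
  have entry: "?\<rho> $ lex_pos [grid_size P s, sep_rank P] [i, \<alpha>] = ?P $$ (i, \<alpha>)"
    if "i < grid_size P s" "\<alpha> < sep_rank P" for i \<alpha>
    using compressed_residual_eq_P_mat[OF Y_dim residual_canonical s that] .
  have P: "?P \<in> carrier_mat (grid_size P s) (sep_rank P)"
    using Y_dim[OF s] by (rule P_mat_carrier)
  \<comment> \<open>Both vectors have length \<open>grid_size P s * sep_rank P\<close>, and each
    position below it is that of a pair, so \<open>entry\<close> covers every component.\<close>
  have "?\<rho> = vectorize ?P"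
  proof (rule eq_vecI)
    show "dim_vec ?\<rho> = dim_vec (vectorize ?P)"
      using P carrier_vecD[OF compressed_residual_carrier] by (auto simp: vectorize_def)
    fix q assume "q < dim_vec (vectorize ?P)"
    then have "q < grid_size P s * sep_rank P"
      using P by (simp add: vectorize_def)
    then show "?\<rho> $ q = vectorize ?P $ q"
      by (rule lex_pos_pair_cases) (simp add: entry vectorize_lex_pos[OF P])
  qed
  then show ?thesis
    using entry P Y_dim compressed_residual_carrier Q_mat_carrier Q_minus_mat_carrier by blast
qed

end
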